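(* There is an absolute constant $\kappa>0$ such that for every $\varepsilon\in(0,1/4)$ the following holds: if $\beta$ is such that every instance of the coloured bin packing problem admits a $(1+\varepsilon,\beta)$-approximate packing, then $\beta\ge \kappa/\varepsilon$. That is, with bin stretch $1+\varepsilon$ it is impossible to achieve colour stretch better than $\Omega(1/\varepsilon)$.
   Context: Coloured bin packing: an instance $I$ is a finite set of items, each item $e$ having a size $s(e)\in(0,1]$ and a colour $c(e)\in C=\{1,\dots,m\}$; items are to be packed into unit-capacity bins (the total size of items in a bin is at most $1$). $I_c$ denotes the set of items of colour $c$. $\mathrm{OPT}(I)$ (resp. $\mathrm{OPT}(I_c)$) is the minimum number of bins needed to pack $I$ (resp. $I_c$). For a packing $P$ of $I$, $P(I)$ is the number of bins used and $P_c(I)$ is the number of bins containing at least one item of colour $c$. A packing is $(\alpha,\beta)$-approximate if $P(I)\le \alpha\,\mathrm{OPT}(I)+O(1)$ and $P_c(I)\le \beta\,\mathrm{OPT}(I_c)+O(1)$ for every colour $c$, where the additive constants are independent of the instance ($\alpha$ is called the bin stretch, $\beta$ the colour stretch). *)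

theory Defs
  imports Complex_Main "HOL-Library.Disjoint_Sets"
begin

text \<open>Items are labelled by natural numbers, so every finite set of items can be represented;
  sizes and colours are only relevant on the items of the instance.  The number \<open>m\<close> of colours is
  part of the instance.\<close>

record cbp =
  items :: "nat set"
  item_size :: "nat \<Rightarrow> real"
  item_colour :: "nat \<Rightarrow> nat"
  num_colours :: nat

definition cbp_instance :: "cbp \<Rightarrow> bool" where
  "cbp_instance I \<longleftrightarrow> finite (items I) \<and>
     (\<forall>e\<in>items I. 0 < item_size I e \<and> item_size I e \<le> 1 \<and>
        item_colour I e \<in> {1..num_colours I})"

definition colour_part :: "cbp \<Rightarrow> nat \<Rightarrow> cbp" where
  "colour_part I c = I\<lparr>items := {e \<in> items I. item_colour I e = c}\<rparr>"

text \<open>A packing is the set of its bins, each bin being the set of items in it.  As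
  \<open>partition_on\<close> excludes the empty set, only bins actually in use are counted.\<close>

definition packing :: "cbp \<Rightarrow> nat set set \<Rightarrow> bool" where
  "packing I P \<longleftrightarrow> partition_on (items I) P \<and> (\<forall>B\<in>P. sum (item_size I) B \<le> 1)"

definition OPT :: "cbp \<Rightarrow> nat" where
  "OPT I = (LEAST k. \<exists>P. packing I P \<and> card P = k)"

definition colour_bins :: "cbp \<Rightarrow> nat set set \<Rightarrow> nat \<Rightarrow> nat" where
  "colour_bins I P c = card {B \<in> P. \<exists>e\<in>B. item_colour I e = c}"

text \<open>The additive terms \<open>O(1)\<close> are the explicit constants \<open>K\<close> and \<open>L\<close>, which
  \<open>admits_approx\<close> requires to be the same for all instances, whatever their number of colours.\<close>

definition approx_packing ::
    "real \<Rightarrow> real \<Rightarrow> real \<Rightarrow> real \<Rightarrow> cbp \<Rightarrow> nat set set \<Rightarrow> bool" where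
  "approx_packing \<alpha> \<beta> K L I P \<longleftrightarrow> packing I P \<and>
     real (card P) \<le> \<alpha> * real (OPT I) + K \<and>
     (\<forall>c\<in>{1..num_colours I}.
        real (colour_bins I P c) \<le> \<beta> * real (OPT (colour_part I c)) + L)"

definition admits_approx :: "real \<Rightarrow> real \<Rightarrow> bool" where
  "admits_approx \<alpha> \<beta> \<longleftrightarrow>
     (\<exists>K L. \<forall>I. cbp_instance I \<longrightarrow> (\<exists>P. approx_packing \<alpha> \<beta> K L I P))"

end

(* Take N items of size 1 - d and N items of size d, where d = 2 \<epsilon>, in two colours.  Pairing
   a large item with a small one packs everything into N bins, so a packing of bin stretch 1 + \<epsilon>
   has only about \<epsilon> N bins without a large item, and these hold at most half of the small items.
   The others sit one by one next to a large item, so the small colour meets about N / 2 bins,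
   although about 2 \<epsilon> N bins suffice for it alone. *)

theory Submission
  imports Defs
begin

lemma OPT_le:
  assumes "packing I P"
  shows "OPT I \<le> card P"
  unfolding OPT_def using assms by (intro Least_le) blast

text \<open>The fibres of \<open>f\<close> serve as bins. Empty fibres are discarded because a
  packing has only nonempty bins, so at most \<open>n\<close> bins remain.\<close>

lemma OPT_le_assignment:
  fixes f :: "nat \<Rightarrow> nat"
  assumes f: "\<And>e. e \<in> items I \<Longrightarrow> f e < n"
    and load: "\<And>j. j < n \<Longrightarrow> sum (item_size I) {e \<in> items I. f e = j} \<le> 1"
  shows "OPT I \<le> n"
proof -
  define P where "P = (\<lambda>j. {e \<in> items I. f e = j}) ` {..<n} - {{}}"
  have "partition_on (items I) P"
    unfolding P_def using f by (intro partition_onI) (auto simp: disjnt_iff)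
  moreover have "\<forall>B\<in>P. sum (item_size I) B \<le> 1"
    unfolding P_def using load by auto
  ultimately have "OPT I \<le> card P"
    by (intro OPT_le) (simp add: packing_def)
  also have "card P \<le> card ((\<lambda>j. {e \<in> items I. f e = j}) ` {..<n})"
    unfolding P_def by (intro card_mono) auto
  also have "\<dots> \<le> n"
    using card_image_le[of "{..<n}"] by force
  finally show ?thesis .
qed

definition bad_instance :: "real \<Rightarrow> nat \<Rightarrow> cbp" where
  "bad_instance d N =
     \<lparr>items = {..<2 * N}, item_size = (\<lambda>e. if e < N then 1 - d else d),
      item_colour = (\<lambda>e. if e < N then 1 else 2), num_colours = 2\<rparr>"

lemma bad_instance_simps [simp]:
  "items (bad_instance d N) = {..<2 * N}"
  "item_size (bad_instance d N) = (\<lambda>e. if e < N then 1 - d else d)"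
  "item_colour (bad_instance d N) = (\<lambda>e. if e < N then 1 else 2)"
  "num_colours (bad_instance d N) = 2"
  by (simp_all add: bad_instance_def)

lemma cbp_instance_bad_instance:
  assumes "0 < d" "d < 1"
  shows "cbp_instance (bad_instance d N)"
  using assms by (auto simp: cbp_instance_def)

text \<open>Reduction modulo \<open>N\<close> puts large item \<open>j\<close> and small item
  \<open>j + N\<close> together, and their sizes add up to exactly 1.\<close>

lemma OPT_bad_instance_le: "OPT (bad_instance d N) \<le> N"
proof (rule OPT_le_assignment[where f = "\<lambda>e. e mod N"])
  fix j assume j: "j < N"
  have "{e \<in> {..<2 * N}. e mod N = j} = {j, j + N}"
  proof (intro set_eqI iffI)
    fix e assume e: "e \<in> {e \<in> {..<2 * N}. e mod N = j}"
    show "e \<in> {j, j + N}"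
    proof (cases "e < N")
      case False
      then have "e mod N = (e - N) mod N" "e - N < N"
        using e by (auto simp: le_mod_geq)
      then have "e mod N = e - N"
        by simp
      then show ?thesis
        using False e by auto
    qed (use e in auto)
  qed (use j in auto)
  then show "sum (item_size (bad_instance d N)) {e \<in> items (bad_instance d N). e mod N = j} \<le> 1"
    using j by simp
qed auto

text \<open>Since the number of small items is a multiple of \<open>q\<close>, they split into
  \<open>n\<close> blocks of \<open>q\<close> consecutive labels, and each block fits into one
  bin.\<close>

lemma OPT_small_colour_le:
  assumes "0 < d" "real q * d \<le> 1" "q > 0"
  shows "OPT (colour_part (bad_instance d (q * n)) 2) \<le> n"
proof (rule OPT_le_assignment[where f = "\<lambda>e. (e - q * n) div q"])
  fix j
  let ?I = "colour_part (bad_instance d (q * n)) 2"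
  let ?F = "{e \<in> items ?I. (e - q * n) div q = j}"
  have sub: "?F \<subseteq> {q * n + q * j..<q * n + q * j + q}"
  proof
    fix e assume "e \<in> ?F"
    then have e: "q * n \<le> e" "(e - q * n) div q = j"
      by (auto simp: colour_part_def split: if_splits)
    have "e - q * n = q * j + (e - q * n) mod q"
      using e(2) by (metis mult_div_mod_eq)
    moreover have "(e - q * n) mod q < q"
      using assms(3) by simp
    ultimately show "e \<in> {q * n + q * j..<q * n + q * j + q}"
      using e(1) by auto
  qed
  have "sum (item_size ?I) ?F = (\<Sum>e\<in>?F. d)"
    by (intro sum.cong) (auto simp: colour_part_def)
  also have "\<dots> = real (card ?F) * d"
    by simp
  also have "\<dots> \<le> real q * d"
    using card_mono[OF _ sub] assms(1) by (intro mult_right_mono) auto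
  finally show "sum (item_size ?I) ?F \<le> 1"
    using assms(2) by simp
next
  fix e assume "e \<in> items (colour_part (bad_instance d (q * n)) 2)"
  then show "(e - q * n) div q < n"
    using assms(3) by (auto simp: colour_part_def less_mult_imp_div_less mult.commute)
qed

text \<open>Here \<open>a\<close> and \<open>b\<close> count the large and small items of a bin. Two
  large items overflow it as \<open>d < 1/2\<close>. Next to one large item there is room
  \<open>d\<close>, hence for one small item only. Without large items at most \<open>q\<close>
  small ones fit.\<close>

lemma bin_weight_le:
  fixes a b q :: nat
  assumes d: "0 < d" "d < 1/2" and q: "1 < real (Suc q) * d"
    and size: "real a * (1 - d) + real b * d \<le> 1"
  shows "q * a + b \<le> q + (if b > 0 then 1 else 0)"
proof -
  have "a < 2"
  proof (rule ccontr)
    assume "\<not> a < 2"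
    then have "2 * (1 - d) \<le> real a * (1 - d)"
      using d by (intro mult_right_mono) auto
    also have "\<dots> \<le> real a * (1 - d) + real b * d"
      using d by simp
    also note size
    finally show False
      using d by simp
  qed
  then consider "a = 0" | "a = 1"
    by linarith
  then show ?thesis
  proof cases
    case 1
    have "real b * d < real (Suc q) * d"
      using size q 1 by simp
    then have "b < Suc q"
      using d by simp
    then show ?thesis
      using 1 by simp
  next
    case 2
    then have "real b * d \<le> 1 * d"
      using size by simp
    then have "b \<le> 1"
      using d by simp
    then show ?thesis
      using 2 by simp
  qed
qed

text \<open>Counting every large item with weight \<open>q\<close> and every small item with weight 1, a bin has
  weight at most \<open>q\<close>, plus 1 if it contains a small item.\<close>

lemma small_colour_bins_ge:
  assumes d: "0 < d" "d < 1/2" and q: "1 < real (Suc q) * d"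
    and P: "packing (bad_instance d N) P"
  shows "q * N + N \<le> q * card P + colour_bins (bad_instance d N) P 2"
proof -
  let ?w = "\<lambda>e. if e < N then q else 1"
  have part: "partition_on {..<2 * N} P"
    and size: "\<And>B. B \<in> P \<Longrightarrow> (\<Sum>e\<in>B. if e < N then 1 - d else d) \<le> 1"
    using P by (auto simp: packing_def)
  have un: "\<Union> P = {..<2 * N}"
    using part by (simp add: partition_on_def)
  have finP: "finite P"
    using finite_elements[OF _ part] by simp
  have fin: "finite B" if "B \<in> P" for B
    using that un by (metis Union_upper finite_lessThan finite_subset)
  have split: "{..<2 * N} \<inter> {e. e < N} = {..<N}" "{..<2 * N} \<inter> - {e. e < N} = {N..<2 * N}"
    by auto
  have "q * N + N = (\<Sum>e<2 * N. ?w e)"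
    by (simp add: sum.If_cases split)
  also have "\<dots> = (\<Sum>B\<in>P. \<Sum>e\<in>B. ?w e)"
    using part fin unfolding un[symmetric]
    by (subst sum.Union_disjoint) (auto simp: partition_on_def disjoint_def)
  also have "\<dots> \<le> (\<Sum>B\<in>P. q + (if \<exists>e\<in>B. \<not> e < N then 1 else 0))"
  proof (rule sum_mono)
    fix B assume B: "B \<in> P"
    let ?a = "card (B \<inter> {e. e < N})" and ?b = "card (B \<inter> - {e. e < N})"
    have "(\<Sum>e\<in>B. ?w e) = q * ?a + ?b"
      using fin[OF B] by (simp add: sum.If_cases)
    also have "\<dots> \<le> q + (if ?b > 0 then 1 else 0)"
      using size[OF B] fin[OF B] by (intro bin_weight_le[OF d q]) (simp add: sum.If_cases)
    also have "?b > 0 \<longleftrightarrow> (\<exists>e\<in>B. \<not> e < N)"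
      using fin[OF B] by (auto simp: card_gt_0_iff)
    finally show "(\<Sum>e\<in>B. ?w e) \<le> q + (if \<exists>e\<in>B. \<not> e < N then 1 else 0)" .
  qed
  also have "\<dots> = q * card P + card (P \<inter> {B. \<exists>e\<in>B. \<not> e < N})"
    using finP by (simp add: sum.distrib sum.If_cases)
  also have "P \<inter> {B. \<exists>e\<in>B. \<not> e < N} =
      {B \<in> P. \<exists>e\<in>B. item_colour (bad_instance d N) e = 2}"
    by auto
  finally show ?thesis
    unfolding colour_bins_def .
qed

lemma colour_stretch_ge:
  fixes \<epsilon> \<beta> :: real and q :: nat
  assumes \<epsilon>: "0 < \<epsilon>" "\<epsilon> < 1/4"
    and q: "q > 0" "real q * (2 * \<epsilon>) \<le> 1" "1 < real (Suc q) * (2 * \<epsilon>)"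
    and approx: "admits_approx (1 + \<epsilon>) \<beta>"
  shows "real q / 2 \<le> \<beta>"
proof -
  obtain K L where KL: "\<And>I. cbp_instance I \<Longrightarrow> \<exists>P. approx_packing (1 + \<epsilon>) \<beta> K L I P"
    using approx unfolding admits_approx_def by blast
  \<comment> \<open>Nothing is known about the sign of \<open>\<beta>\<close>, but replacing
    \<open>OPT\<close> by its upper bound \<open>n\<close> requires a nonnegative factor.\<close>
  define b where "b = max \<beta> 0"
  \<comment> \<open>The right-hand side does not depend on \<open>n\<close>, so letting
    \<open>n\<close> grow eliminates the additive constants.\<close>
  have bound: "real n * (real q / 2 - b) \<le> L + real q * K" for n
  proof -
    define N where "N = q * n"
    let ?I = "bad_instance (2 * \<epsilon>) N"
    obtain P where "approx_packing (1 + \<epsilon>) \<beta> K L ?I P"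
      using KL cbp_instance_bad_instance[of "2 * \<epsilon>" N] \<epsilon> by auto
    then have P: "packing ?I P" "real (card P) \<le> (1 + \<epsilon>) * real (OPT ?I) + K"
        "real (colour_bins ?I P 2) \<le> \<beta> * real (OPT (colour_part ?I 2)) + L"
      by (auto simp: approx_packing_def)
    have "(1 + \<epsilon>) * real (OPT ?I) \<le> (1 + \<epsilon>) * real N"
      using OPT_bad_instance_le \<epsilon> by (intro mult_left_mono) auto
    with P(2) have "real q * real (card P) \<le> real q * ((1 + \<epsilon>) * real N + K)"
      by (intro mult_left_mono) auto
    moreover have "\<beta> * real (OPT (colour_part ?I 2)) \<le> b * real n"
      using OPT_small_colour_le[of "2 * \<epsilon>" q n] \<epsilon> q
      unfolding N_def b_def by (intro mult_mono) auto
    moreover have "real (q * N + N) \<le> real (q * card P + colour_bins ?I P 2)"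
      using small_colour_bins_ge[OF _ _ q(3) P(1)] \<epsilon> by (intro of_nat_mono) auto
    \<comment> \<open>The choice \<open>d = 2 * \<epsilon>\<close> enters here: the \<epsilon> N
      extra bins absorb at most half of the small items, each taking at most
      \<open>q\<close>.\<close>
    moreover have "real q * \<epsilon> * real N \<le> 1 / 2 * real N"
      using q(2) by (intro mult_right_mono) auto
    ultimately have "real N / 2 \<le> real q * K + b * real n + L"
      using P(3) by (simp add: algebra_simps)
    then show ?thesis
      by (simp add: N_def algebra_simps)
  qed
  have "real q / 2 \<le> b"
  proof (rule ccontr)
    assume "\<not> real q / 2 \<le> b"
    then obtain n where "L + real q * K < real n * (real q / 2 - b)"
      using reals_Archimedean3[of "real q / 2 - b"] by auto
    with bound[of n] show False
      by simp
  qed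
  \<comment> \<open>As \<open>q > 0\<close>, the bound forces \<open>b\<close> to be positive, so
    \<open>b\<close> is \<open>\<beta>\<close> itself.\<close>
  then show ?thesis
    using q(1) by (auto simp: b_def max_def split: if_splits)
qed

theorem theorem1:
  "\<exists>\<kappa>::real. \<kappa> > 0 \<and>
     (\<forall>\<epsilon>\<in>{0<..<1/4}. \<forall>\<beta>. admits_approx (1 + \<epsilon>) \<beta> \<longrightarrow> \<beta> \<ge> \<kappa> / \<epsilon>)"
proof (intro exI[of _ "1/8"] conjI ballI allI impI)
  fix \<epsilon> \<beta> :: real
  assume "\<epsilon> \<in> {0<..<1/4}" and approx: "admits_approx (1 + \<epsilon>) \<beta>"
  then have \<epsilon>: "0 < \<epsilon>" "\<epsilon> < 1/4"
    by auto
  define q where "q = nat \<lfloor>1 / (2 * \<epsilon>)\<rfloor>"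
  \<comment> \<open>Rounding down a number above 2 loses less than half of it, which gives
    \<open>1 / (4 * \<epsilon>) \<le> real q\<close>. Halving once more in
    \<open>colour_stretch_ge\<close> yields the constant 1/8.\<close>
  have "2 < 1 / (2 * \<epsilon>)"
    using \<epsilon> by (simp add: field_simps)
  then have q: "real q \<le> 1 / (2 * \<epsilon>)" "1 / (2 * \<epsilon>) < real q + 1" "1 / (4 * \<epsilon>) \<le> real q" "q > 0"
    unfolding q_def by linarith+
  have "1 / 8 / \<epsilon> \<le> real q / 2"
    using q(3) by simp
  also have "\<dots> \<le> \<beta>"
    using q(1,2,4) \<epsilon> by (intro colour_stretch_ge[OF \<epsilon> _ _ _ approx]) (simp_all add: field_simps)
  finally show "1 / 8 / \<epsilon> \<le> \<beta>" .
qed simp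

end
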